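(* Let $(g,u)$ be an $n$-person game in normal form, where $g : X = X_1 \times \cdots \times X_n \to A$ is a game form and $u=(u_1,\ldots,u_n)$ is a preference profile. Then any domination equilibrium of $(g,u)$ is a Nash equilibrium (in pure strategies) of $(g,u)$.
   Context: Let $I=\{1,\ldots,n\}$ be the set of players; each player $i\in I$ has a finite non-empty set of strategies $X_i$, and $X = X_1\times\cdots\times X_n$ is the set of strategy profiles. A game form is a mapping $g : X \to A$, where $A=\{a_1,\ldots,a_p\}$ is a finite set of outcomes. A preference profile $u=(u_1,\ldots,u_n)$ assigns to each player $i$ a complete strict order $u_i$ over $A$; equivalently, each player $i$ has a function $u(i,\cdot): A \to \mathbb{R}$ such that $u(i,a)=u(i,a')$ implies $a=a'$ (only the order matters). Write $u(i,x)=u(i,g(x))$ for $x \in X$. The pair $(g,u)$ is a game in normal form. Nash equilibrium: a profile $x\in X$ such that $u(i,x)\ge u(i,x')$ for every $i\in I$ and every $x'\in X$ that coincides with $x$ in all coordinates except possibly the $i$-th. Box: $Y=Y_1\times\cdots\times Y_n$ is a box of $X$, written $Y\subseteq X$, if $\emptyset\ne Y_i\subseteq X_i$ for all $i\in I$. Domination modulo a box: for a box $Y\subseteq X$, a player $i$ and two strategies $x_i,x'_i\in X_i$, we write $x_i\succeq x'_i \mod Y$ if $u(i,x)\ge u(i,x')$ for every two profiles $x,x' \in X$ whose $i$-th coordinates are $x_i$ and $x'_i$ respectively and such that $x_j=x'_j\in Y_j$ for all $j\in I\setminus\{i\}$. D-box: starting from $X$, successively eliminate dominated strategies of (possibly different)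 players one by one, in some order. One step passes from a current box $Z$ to the box obtained by deleting from $Z_i$, for some $i\in I$, a strategy $x'_i\in Z_i$ such that $x_i\succeq x'_i \mod Z$ for some $x_i\in Z_i$, $x_i\neq x'_i$. Any box obtained from $X$ by finitely many (possibly zero) such steps is called a D-box of $X$. A box $Y$ is domination-free if for no $i\in I$ there are two distinct strategies $x_i,x'_i\in Y_i$ with $x_i\succeq x'_i \mod Y$. A domination-free D-box is called terminal. A terminal D-box that consists of a unique strategy profile is called a domination equilibrium (and is identified with that profile). *)

theory Defs
  imports Complex_Main "HOL-Library.FuncSet"
begin

text \<open>
  The strategies of all players live in a common type; player \<open>i\<close> has strategy set \<open>X i\<close>. Only the
  values of \<open>X\<close>, and of the families representing boxes, at the players \<open>1, \<dots>, n\<close> are relevant.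
  A preference \<open>u i\<close> is a real-valued function, injective on the outcomes; for a game form \<open>g\<close>,
  the value of profile \<open>x\<close> to player \<open>i\<close> is \<open>u i (g x)\<close>.
\<close>

definition players :: "nat \<Rightarrow> nat set" where
  "players n = {1..n}"

definition profiles :: "nat \<Rightarrow> (nat \<Rightarrow> 's set) \<Rightarrow> (nat \<Rightarrow> 's) set" where
  "profiles n X = (\<Pi>\<^sub>E i\<in>players n. X i)"

definition normal_form_game ::
  "nat \<Rightarrow> (nat \<Rightarrow> 's set) \<Rightarrow> 'a set \<Rightarrow> ((nat \<Rightarrow> 's) \<Rightarrow> 'a) \<Rightarrow> (nat \<Rightarrow> 'a \<Rightarrow> real) \<Rightarrow> bool" where
  "normal_form_game n X A g u \<longleftrightarrow>
     (\<forall>i\<in>players n. finite (X i) \<and> X i \<noteq> {}) \<and>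
     finite A \<and>
     g \<in> profiles n X \<rightarrow> A \<and>
     (\<forall>i\<in>players n. inj_on (u i) A)"

definition nash_equilibrium ::
  "nat \<Rightarrow> (nat \<Rightarrow> 's set) \<Rightarrow> ((nat \<Rightarrow> 's) \<Rightarrow> 'a) \<Rightarrow> (nat \<Rightarrow> 'a \<Rightarrow> real) \<Rightarrow> (nat \<Rightarrow> 's) \<Rightarrow> bool" where
  "nash_equilibrium n X g u x \<longleftrightarrow>
     x \<in> profiles n X \<and>
     (\<forall>i\<in>players n. \<forall>x'\<in>profiles n X.
        (\<forall>j\<in>players n - {i}. x' j = x j) \<longrightarrow> u i (g x) \<ge> u i (g x'))"

definition is_box :: "nat \<Rightarrow> (nat \<Rightarrow> 's set) \<Rightarrow> (nat \<Rightarrow> 's set) \<Rightarrow> bool" where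
  "is_box n X Y \<longleftrightarrow> (\<forall>i\<in>players n. Y i \<noteq> {} \<and> Y i \<subseteq> X i)"

text \<open>
  \<open>dominates_mod n X g u Y i s t\<close> says that \<open>s\<close> dominates \<open>t\<close> for player \<open>i\<close> modulo \<open>Y\<close>;
  \<open>s\<close> and \<open>t\<close> are strategies in \<open>X i\<close>, not necessarily in \<open>Y i\<close>.
\<close>

definition dominates_mod ::
  "nat \<Rightarrow> (nat \<Rightarrow> 's set) \<Rightarrow> ((nat \<Rightarrow> 's) \<Rightarrow> 'a) \<Rightarrow> (nat \<Rightarrow> 'a \<Rightarrow> real) \<Rightarrow>
   (nat \<Rightarrow> 's set) \<Rightarrow> nat \<Rightarrow> 's \<Rightarrow> 's \<Rightarrow> bool" where
  "dominates_mod n X g u Y i s t \<longleftrightarrow>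
     (\<forall>x\<in>profiles n X. \<forall>x'\<in>profiles n X.
        x i = s \<and> x' i = t \<and> (\<forall>j\<in>players n - {i}. x j = x' j \<and> x j \<in> Y j) \<longrightarrow>
        u i (g x) \<ge> u i (g x'))"

inductive D_box ::
  "nat \<Rightarrow> (nat \<Rightarrow> 's set) \<Rightarrow> ((nat \<Rightarrow> 's) \<Rightarrow> 'a) \<Rightarrow> (nat \<Rightarrow> 'a \<Rightarrow> real) \<Rightarrow> (nat \<Rightarrow> 's set) \<Rightarrow> bool"
  for n X g u where
  start: "D_box n X g u X"
| eliminate: "D_box n X g u (Z(i := Z i - {t}))"
    if "D_box n X g u Z" "i \<in> players n" "s \<in> Z i" "t \<in> Z i" "s \<noteq> t"
       "dominates_mod n X g u Z i s t"

definition domination_free ::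
  "nat \<Rightarrow> (nat \<Rightarrow> 's set) \<Rightarrow> ((nat \<Rightarrow> 's) \<Rightarrow> 'a) \<Rightarrow> (nat \<Rightarrow> 'a \<Rightarrow> real) \<Rightarrow> (nat \<Rightarrow> 's set) \<Rightarrow> bool" where
  "domination_free n X g u Y \<longleftrightarrow>
     is_box n X Y \<and>
     \<not> (\<exists>i\<in>players n. \<exists>s\<in>Y i. \<exists>t\<in>Y i. s \<noteq> t \<and> dominates_mod n X g u Y i s t)"

definition terminal_D_box ::
  "nat \<Rightarrow> (nat \<Rightarrow> 's set) \<Rightarrow> ((nat \<Rightarrow> 's) \<Rightarrow> 'a) \<Rightarrow> (nat \<Rightarrow> 'a \<Rightarrow> real) \<Rightarrow> (nat \<Rightarrow> 's set) \<Rightarrow> bool" where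
  "terminal_D_box n X g u Y \<longleftrightarrow> D_box n X g u Y \<and> domination_free n X g u Y"

definition domination_equilibrium ::
  "nat \<Rightarrow> (nat \<Rightarrow> 's set) \<Rightarrow> ((nat \<Rightarrow> 's) \<Rightarrow> 'a) \<Rightarrow> (nat \<Rightarrow> 'a \<Rightarrow> real) \<Rightarrow> (nat \<Rightarrow> 's) \<Rightarrow> bool" where
  "domination_equilibrium n X g u x \<longleftrightarrow>
     (\<exists>Y. terminal_D_box n X g u Y \<and> profiles n Y = {x})"

lemma is_box_D_box:
  assumes "normal_form_game n X A g u" and "D_box n X g u Y"
  shows "is_box n X Y"
  using assms(2,1)
  by (induction rule: D_box.induct) (auto simp: is_box_def normal_form_game_def)

end

theory Submission
  imports Defs
begin

text \<open>
  An eliminated strategy can always be replaced by a surviving one, as long as the opponents are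
  confined to the current box: the dominating strategy is at least as good there, and shrinking the
  opponents' sets further only weakens the requirement. Hence, throughout the elimination, each
  player has a best response among all original strategies that has survived, against every choice
  of surviving strategies by the others. This is the lemma \<open>D_box_weakly_better_response\<close>. When a
  single profile \<open>x\<close> is left, the only surviving response of a player to \<open>x\<close> is the one in \<open>x\<close>
  itself, so no deviation from \<open>x\<close> is profitable.
\<close>

lemma profiles_fun_upd:
  assumes "y \<in> profiles n X" and "i \<in> players n" and "s \<in> X i"
  shows "y(i := s) \<in> profiles n X"
  using assms by (auto simp: profiles_def PiE_iff extensional_def)

text \<open>
  The deviating player's own strategy \<open>y i\<close> ranges over the whole of \<open>X i\<close>: this is what carries the
  conclusion from the final box back to the original game. The induction moves the surviving
  response along only in the step where that response is the strategy being deleted.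
\<close>

lemma D_box_weakly_better_response:
  assumes "normal_form_game n X A g u"
    and "D_box n X g u Y"
    and "i \<in> players n" and "y \<in> profiles n X" and "\<forall>j\<in>players n - {i}. y j \<in> Y j"
  shows "\<exists>s\<in>Y i. u i (g y) \<le> u i (g (y(i := s)))"
  using assms(2-5)
proof (induction arbitrary: i y rule: D_box.induct)
  case start
  then have "y i \<in> X i" by (auto simp: profiles_def)
  then show ?case by (intro bexI[of _ "y i"]) auto
next
  case (eliminate Z k s t)
  have opponents: "\<forall>j\<in>players n - {i}. y j \<in> Z j"
    using eliminate.prems(3) by (auto split: if_splits)
  then obtain r where r: "r \<in> Z i" "u i (g y) \<le> u i (g (y(i := r)))"
    using eliminate.IH eliminate.prems by blast
  show ?case
  proof (cases "i = k \<and> r = t")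
    case False
    with r(1) have "r \<in> (Z(k := Z k - {t})) i" by auto
    with r(2) show ?thesis by blast
  next
    case True
    have "Z i \<subseteq> X i"
      using is_box_D_box[OF assms(1) eliminate.hyps(1)] eliminate.prems(1)
      by (auto simp: is_box_def)
    then have "y(i := s) \<in> profiles n X" "y(i := t) \<in> profiles n X"
      using eliminate.hyps eliminate.prems True by (auto intro!: profiles_fun_upd)
    then have "u i (g (y(i := t))) \<le> u i (g (y(i := s)))"
      using eliminate.hyps(6) True opponents unfolding dominates_mod_def by simp
    with r(2) True have "u i (g y) \<le> u i (g (y(i := s)))" by auto
    moreover have "s \<in> (Z(k := Z k - {t})) i"
      using True eliminate.hyps by simp
    ultimately show ?thesis by blast
  qed
qed

theorem proposition1:
  fixes n :: nat
    and X :: "nat \<Rightarrow> 's set"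
    and A :: "'a set"
    and g :: "(nat \<Rightarrow> 's) \<Rightarrow> 'a"
    and u :: "nat \<Rightarrow> 'a \<Rightarrow> real"
    and x :: "nat \<Rightarrow> 's"
  assumes "normal_form_game n X A g u"
    and "domination_equilibrium n X g u x"
  shows "nash_equilibrium n X g u x"
proof -
  obtain Y where Y: "D_box n X g u Y" "profiles n Y = {x}"
    using assms(2) by (auto simp: domination_equilibrium_def terminal_D_box_def)
  have xY: "x \<in> profiles n Y" using Y(2) by simp
  have "profiles n Y \<subseteq> profiles n X"
    using is_box_D_box[OF assms(1) Y(1)] unfolding profiles_def is_box_def
    by (intro PiE_mono) auto
  with xY have xX: "x \<in> profiles n X" by blast
  have "u i (g x') \<le> u i (g x)"
    if i: "i \<in> players n" and x': "x' \<in> profiles n X" "\<forall>j\<in>players n - {i}. x' j = x j"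
    for i x'
  proof -
    have "\<forall>j\<in>players n - {i}. x' j \<in> Y j"
      using x'(2) xY by (auto simp: profiles_def)
    then obtain s where s: "s \<in> Y i" "u i (g x') \<le> u i (g (x'(i := s)))"
      using D_box_weakly_better_response[OF assms(1) Y(1) i x'(1)] by blast
    \<comment> \<open>Both profiles are undefined outside the players, so agreement on the opponents suffices.\<close>
    have "x'(i := s) = x(i := s)"
    proof
      fix j show "(x'(i := s)) j = (x(i := s)) j"
        using x' xX by (cases "j \<in> players n") (auto simp: profiles_def PiE_iff extensional_def)
    qed
    also have "x(i := s) = x"
      using profiles_fun_upd[OF xY i s(1)] Y(2) by simp
    finally show ?thesis using s(2) by simp
  qed
  with xX show ?thesis unfolding nash_equilibrium_def by blast
qed

end
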